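(* Let $F$ be a field, let $n\geq 2$, and let $a\in M_n(F)$. Then every matrix in $M_n(F)$ is a (finite) sum of matrices of the form $[a,x][a,y]$ with $x,y\in M_n(F)$ if and only if the degree of the minimal polynomial of $a$ is greater than $2$.
   Context: The commutator of $x,y$ in a ring is the additive commutator $[x,y]=xy-yx$. *)

theory Defs
  imports "HOL-Analysis.Analysis" "HOL-Computational_Algebra.Polynomial"
begin

text \<open>Square matrices over a field \<open>'a\<close> are elements of \<open>'a^'n^'n\<close>, with product \<open>**\<close>
  and unit \<open>mat 1\<close>; the product \<open>*\<close> on this type is componentwise and is not used.\<close>

definition commutator :: "'a::ring_1^'n^'n \<Rightarrow> 'a^'n^'n \<Rightarrow> 'a^'n^'n" where
  "commutator x y = x ** y - y ** x"

primrec matrix_power :: "'a::semiring_1^'n^'n \<Rightarrow> nat \<Rightarrow> 'a^'n^'n" where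
  "matrix_power a 0 = mat 1"
| "matrix_power a (Suc k) = a ** matrix_power a k"

text \<open>Here \<open>mat c\<close> is the scalar matrix with diagonal entry \<open>c\<close>.\<close>

definition poly_matrix :: "'a::comm_ring_1 poly \<Rightarrow> 'a^'n^'n \<Rightarrow> 'a^'n^'n" where
  "poly_matrix p a = (\<Sum>i\<le>degree p. mat (coeff p i) ** matrix_power a i)"

definition is_minimal_poly :: "'a::field^'n^'n \<Rightarrow> 'a poly \<Rightarrow> bool" where
  "is_minimal_poly a p \<longleftrightarrow> lead_coeff p = 1 \<and> poly_matrix p a = 0 \<and>
     (\<forall>q. q \<noteq> 0 \<and> poly_matrix q a = 0 \<longrightarrow> degree p \<le> degree q)"

definition minimal_poly :: "'a::field^'n^'n \<Rightarrow> 'a poly" where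
  "minimal_poly a = (THE p. is_minimal_poly a p)"

lemma mat_scalar_mult_component: "(mat c ** (A :: 'a::comm_ring_1^'n^'n)) $ i $ j = c * A $ i $ j"
  by (simp add: matrix_matrix_mult_def mat_def if_distrib cong: if_cong)
    (simp add: if_distribR cong: if_cong)

lemma poly_matrix_component:
  fixes a :: "'a::comm_ring_1^'n^'n"
  assumes "degree p \<le> N"
  shows "poly_matrix p a $ i $ j = (\<Sum>k\<le>N. coeff p k * matrix_power a k $ i $ j)"
proof -
  have "poly_matrix p a $ i $ j = (\<Sum>k\<le>degree p. coeff p k * matrix_power a k $ i $ j)"
    by (simp add: poly_matrix_def mat_scalar_mult_component)
  also have "\<dots> = (\<Sum>k\<le>N. coeff p k * matrix_power a k $ i $ j)"
    by (rule sum.mono_neutral_left) (use assms in \<open>auto simp: coeff_eq_0\<close>)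
  finally show ?thesis .
qed

lemma poly_matrix_diff:
  fixes a :: "'a::comm_ring_1^'n^'n"
  shows "poly_matrix (p - q) a = poly_matrix p a - poly_matrix q a"
proof -
  define N where "N = max (degree p) (degree q)"
  have "degree (p - q) \<le> N" "degree p \<le> N" "degree q \<le> N"
    by (auto simp: N_def degree_diff_le)
  then show ?thesis
    by (simp add: vec_eq_iff poly_matrix_component[where N = N] algebra_simps sum_subtractf)
qed

lemma poly_matrix_smult:
  fixes a :: "'a::comm_ring_1^'n^'n"
  shows "poly_matrix (smult c p) a = mat c ** poly_matrix p a"
  by (simp add: vec_eq_iff mat_scalar_mult_component poly_matrix_component[where N = "degree p"]
      degree_smult_le sum_distrib_left mult.assoc)

lemma annihilating_poly_exists:
  fixes a :: "'a::field^'n^'n"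
  shows "\<exists>p. p \<noteq> 0 \<and> poly_matrix p a = 0"
proof -
  define f :: "nat \<Rightarrow> 'a^('n \<times> 'n)"
    where "f k = (\<chi> ij. matrix_power a k $ fst ij $ snd ij)" for k
  define N where "N = CARD('n \<times> 'n)"
  have *: "p \<noteq> 0 \<and> poly_matrix p a = 0"
    if "p = (\<Sum>k\<le>N. monom (u k) k)" "(\<Sum>k\<le>N. u k *s f k) = 0" "k0 \<le> N" "u k0 \<noteq> 0" for p u k0
  proof
    have c: "coeff p k = (if k \<le> N then u k else 0)" for k
      by (simp add: that(1) coeff_sum)
    then show "p \<noteq> 0" using that(3,4) c[of k0] by (metis coeff_0)
    have "degree p \<le> N" by (rule degree_le) (simp add: c)
    moreover have "(\<Sum>k\<le>N. u k * matrix_power a k $ i $ j) = 0" for i j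
      using arg_cong[OF that(2), of "\<lambda>v. v $ (i, j)"] by (simp add: f_def)
    ultimately show "poly_matrix p a = 0"
      by (simp add: vec_eq_iff poly_matrix_component c)
  qed
  have "\<exists>u k0. (\<Sum>k\<le>N. u k *s f k) = 0 \<and> k0 \<le> N \<and> u k0 \<noteq> 0"
  proof (cases "inj_on f {..N}")
    case True
    have "vec.dependent (f ` {..N})"
    proof (rule ccontr)
      assume "\<not> vec.dependent (f ` {..N})"
      then have "card (f ` {..N}) \<le> vec.dim (UNIV :: ('a^('n \<times> 'n)) set)"
        by (intro vec.independent_card_le_dim) auto
      then show False
        unfolding card_image[OF True] vec_dim_card N_def[symmetric] by simp
    qed
    then obtain u v where u: "v \<in> f ` {..N}" "u v \<noteq> 0" "(\<Sum>v\<in>f ` {..N}. u v *s v) = 0"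
      using vec.dependent_finite[of "f ` {..N}"] by auto
    then obtain k0 where "k0 \<le> N" "v = f k0" by auto
    then show ?thesis using u True
      by (intro exI[of _ "u \<circ> f"] exI[of _ k0]) (simp add: sum.reindex o_def)
  next
    case False
    then obtain k l where kl: "k \<le> N" "l \<le> N" "f k = f l" "k \<noteq> l"
      by (auto simp: inj_on_def)
    let ?u = "\<lambda>m. if m = k then 1 else if m = l then - 1 else (0::'a)"
    have "(\<Sum>m\<le>N. ?u m *s f m) = (\<Sum>m\<in>{k, l}. ?u m *s f m)"
      by (rule sum.mono_neutral_right) (use kl in auto)
    also have "\<dots> = 0" using kl by (simp add: vec_eq_iff)
    finally show ?thesis using kl by (intro exI[of _ ?u] exI[of _ k]) simp
  qed
  then show ?thesis using * by blast
qed

lemma minimal_poly_unique_exists: "\<exists>!p. is_minimal_poly a p"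
proof (rule ex_ex1I)
  define P where "P p \<longleftrightarrow> p \<noteq> 0 \<and> poly_matrix p a = 0" for p
  obtain p0 where "P p0" using annihilating_poly_exists[of a] by (auto simp: P_def)
  then obtain p where p: "P p" "\<And>q. P q \<Longrightarrow> degree p \<le> degree q"
    using ex_has_least_nat[of P p0 degree] by blast
  have "is_minimal_poly a (smult (inverse (lead_coeff p)) p)"
    using p by (auto simp: is_minimal_poly_def P_def poly_matrix_smult)
  then show "\<exists>p. is_minimal_poly a p" ..
next
  fix p q assume pq: "is_minimal_poly a p" "is_minimal_poly a q"
  show "p = q"
  proof (rule ccontr)
    assume "p \<noteq> q"
    then have d0: "p - q \<noteq> 0" by simp
    have "p \<noteq> 0" "q \<noteq> 0" and lc: "lead_coeff p = lead_coeff q"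
      using pq by (auto simp: is_minimal_poly_def)
    then have deg: "degree p = degree q"
      using pq by (simp add: is_minimal_poly_def antisym)
    with lc have c: "coeff (p - q) (degree p) = 0" by simp
    have "degree p \<le> degree (p - q)"
      using pq d0 by (simp add: is_minimal_poly_def poly_matrix_diff)
    moreover have "degree (p - q) \<le> degree p" using deg by (simp add: degree_diff_le)
    ultimately have "degree (p - q) = degree p" by simp
    with c d0 show False by (metis leading_coeff_0_iff)
  qed
qed

lemma is_minimal_poly_minimal_poly: "is_minimal_poly a (minimal_poly a)"
  unfolding minimal_poly_def by (rule theI'[OF minimal_poly_unique_exists])

end

theory Submission
  imports Defs
begin

text \<open>The sums of products \<open>[a,x][a,y]\<close> form a subspace. If it is proper, some \<open>w \<noteq> 0\<close>
  is orthogonal to it under the trace form. Since \<open>tr (w[a,x][a,y]) = tr ([w[a,x],a] y)\<close>,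
  each \<open>w[a,x]\<close> commutes with \<open>a\<close>, that is,
  \<open>awa x - (wa + aw) x a + w x a\<^sup>2 = 0\<close> for all \<open>x\<close>; independence of \<open>1\<close>, \<open>a\<close>, \<open>a\<^sup>2\<close>
  then forces \<open>w = 0\<close>. Conversely, if \<open>a\<^sup>2 = u + v a\<close>, then
  \<open>a[a,z] = [a,z](v - a)\<close>, so moving \<open>a\<close> past two commutators shows that every
  \<open>[a,x][a,y]\<close> commutes with \<open>a\<close>; if these products spanned, \<open>a\<close> would be central and
  all the commutators would vanish.\<close>

section \<open>Matrix units and the trace form\<close>

definition matrix_unit :: "'n \<Rightarrow> 'n \<Rightarrow> 'a::semiring_1^'n^'n" where
  "matrix_unit k l = (\<chi> i j. if i = k \<and> j = l then 1 else 0)"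

lemma matrix_mult_matrix_unit:
  "(m ** matrix_unit k l) $ i $ j = (if j = l then m $ i $ k else 0)"
  for m :: "'a::semiring_1^'n^'n"
  by (simp add: matrix_matrix_mult_def matrix_unit_def if_distrib sum.If_cases cong: if_cong)

lemma matrix_mult_matrix_unit_mult:
  "(m ** matrix_unit k l ** q) $ i $ j = m $ i $ k * q $ l $ j"
  for m q :: "'a::semiring_1^'n^'n"
  unfolding matrix_matrix_mult_def[of "m ** matrix_unit k l"]
  by (simp add: matrix_mult_matrix_unit if_distrib[of "\<lambda>z. z * _"] cong: if_cong)

lemma trace_mult_matrix_unit: "trace (m ** matrix_unit k l) = m $ l $ k"
  for m :: "'a::semiring_1^'n^'n"
  by (simp add: trace_def matrix_mult_matrix_unit)

lemma trace_form_nondegenerate: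
  fixes m :: "'a::semiring_1^'n^'n"
  assumes "\<And>y. trace (m ** y) = 0"
  shows "m = 0"
  using assms[of "matrix_unit _ _"] by (simp add: vec_eq_iff trace_mult_matrix_unit)

lemma matrix_matrix_unit_expansion:
  fixes A :: "'a::comm_ring_1^'n^'n"
  shows "A = (\<Sum>i\<in>UNIV. \<Sum>j\<in>UNIV. mat (A $ i $ j) ** matrix_unit i j)"
proof -
  have "(mat (A $ k $ l) ** matrix_unit k l) $ i $ j
      = (if k = i then if l = j then A $ i $ j else 0 else 0)" for i j k l
    by (simp add: mat_scalar_mult_component matrix_unit_def)
  moreover have "(\<Sum>l\<in>UNIV. if k = i then if l = j then A $ i $ j else 0 else 0)
      = (if k = i then A $ i $ j else 0)" for i j k
    by (cases "k = i") simp_all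
  ultimately show ?thesis
    by (simp add: vec_eq_iff)
qed

lemma mat_component: "mat c $ i $ j = (if i = j then c else 0)"
  by (simp add: mat_def)

lemma matrix_add_rdistrib: "(A + B) ** C = A ** C + B ** C" for A :: "'a::semiring_1^'n^'n"
  by (simp add: vec_eq_iff matrix_matrix_mult_def algebra_simps sum.distrib)

lemma matrix_sub_ldistrib: "A ** (B - C) = A ** B - A ** C" for A :: "'a::ring_1^'n^'n"
  by (simp add: vec_eq_iff matrix_matrix_mult_def algebra_simps sum_subtractf)

lemma matrix_sub_rdistrib: "(A - B) ** C = A ** C - B ** C" for A :: "'a::ring_1^'n^'n"
  by (simp add: vec_eq_iff matrix_matrix_mult_def algebra_simps sum_subtractf)

lemma mat_mult_commute: "A ** mat c = mat c ** A" for A :: "'a::comm_ring_1^'n^'n"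
  by (simp add: vec_eq_iff mat_scalar_mult_component)
    (simp add: matrix_matrix_mult_def mat_def if_distrib mult.commute cong: if_cong)

lemmas matrix_ring_simps = matrix_mul_assoc matrix_add_ldistrib matrix_add_rdistrib
  matrix_sub_ldistrib matrix_sub_rdistrib

text \<open>With scalars acting through \<open>mat c\<close>, the abstract theory of bases and
  linear extension applies to matrices over any field.\<close>

lemma vector_space_mat: "vector_space (\<lambda>c (A :: 'a::field^'n^'n). mat c ** A)"
  by unfold_locales (simp_all add: vec_eq_iff mat_scalar_mult_component algebra_simps)

text \<open>A basis of \<open>V\<close> stays independent after adjoining \<open>b\<close>, so some
  linear functional is 1 at \<open>b\<close> and 0 on \<open>V\<close>; every functional on matrices
  is a trace form.\<close>

lemma proper_subspace_trace_annihilator: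
  fixes V :: "('a::field^'n^'n) set"
  assumes zero: "0 \<in> V"
    and add: "\<And>A B. A \<in> V \<Longrightarrow> B \<in> V \<Longrightarrow> A + B \<in> V"
    and scale: "\<And>c A. A \<in> V \<Longrightarrow> mat c ** A \<in> V"
    and b: "b \<notin> V"
  obtains w where "w \<noteq> 0" "\<And>A. A \<in> V \<Longrightarrow> trace (w ** A) = 0"
proof -
  interpret M: vector_space "\<lambda>c (A :: 'a^'n^'n). mat c ** A" by (rule vector_space_mat)
  interpret F: vector_space "(*) :: 'a \<Rightarrow> 'a \<Rightarrow> 'a" by unfold_locales (simp_all add: algebra_simps)
  interpret P: vector_space_pair "\<lambda>c (A :: 'a^'n^'n). mat c ** A" "(*) :: 'a \<Rightarrow> 'a \<Rightarrow> 'a" ..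
  have "M.subspace V" using zero add scale by (simp add: M.subspace_def)
  obtain B where B: "B \<subseteq> V" "M.independent B" "V \<subseteq> M.span B"
    using M.maximal_independent_subset[of V] by blast
  have spanB: "M.span B = V"
    using B \<open>M.subspace V\<close> by (simp add: M.span_subspace)
  then have "M.independent (insert b B)"
    using B b by (simp add: M.independent_insert)
  then obtain g where g: "Vector_Spaces.linear (\<lambda>c (A :: 'a^'n^'n). mat c ** A) (*) g" "\<forall>x\<in>insert b B. g x = (if x = b then 1 else 0)"
    using P.linear_independent_extend[of "insert b B" "\<lambda>x. if x = b then 1 else 0"] by blast
  have gV: "g A = 0" if "A \<in> V" for A
    using P.linear_eq_0_on_span[OF g(1), of B A] g(2) B(1) b that spanB by (metis insertCI subsetD)
  \<comment> \<open>The indices are transposed because the trace of \<open>w ** A\<close> pairs the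
    entry (i, j) of \<open>w\<close> with the entry (j, i) of \<open>A\<close>.\<close>
  define w where "w = (\<chi> i j. g (matrix_unit j i))"
  have gw: "g A = trace (w ** A)" for A
  proof -
    have "g A = (\<Sum>i\<in>UNIV. \<Sum>j\<in>UNIV. A $ i $ j * g (matrix_unit i j))"
      by (subst matrix_matrix_unit_expansion) (simp add: P.linear_sum[OF g(1)] P.linear_scale[OF g(1)])
    also have "\<dots> = trace (w ** A)"
      unfolding trace_def matrix_matrix_mult_def w_def
      by (subst sum.swap) (simp add: mult.commute)
    finally show ?thesis .
  qed
  show thesis
  proof (rule that[of w])
    show "w \<noteq> 0"
    proof
      assume "w = 0"
      then have "g b = 0" by (simp add: gw trace_def)
      then show False using g(2) by simp
    qed
  qed (use gV gw in simp)
qed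

section \<open>Quadratic relations and degree greater than 2\<close>

lemma poly_matrix_quadratic:
  fixes a :: "'a::comm_ring_1^'n^'n"
  assumes "degree p \<le> 2"
  shows "poly_matrix p a = mat (coeff p 0) + mat (coeff p 1) ** a + mat (coeff p 2) ** (a ** a)"
  using assms
  by (simp add: vec_eq_iff poly_matrix_component[where N = 2] mat_scalar_mult_component
      numeral_2_eq_2)
    (simp add: mat_def)

text \<open>A nontrivial relation would be a nonzero annihilating polynomial of degree at most 2,
  against minimality.\<close>

lemma linear_independent_powers:
  fixes a :: "'a::field^'n^'n"
  assumes "degree (minimal_poly a) > 2"
    and "mat r + mat s ** a + mat t ** (a ** a) = 0"
  shows "r = 0 \<and> s = 0 \<and> t = 0"
proof -
  let ?q = "[:r, s, t:]"
  have deg: "degree ?q \<le> 2" by (simp add: degree_pCons_eq_if)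
  then have "poly_matrix ?q a = 0"
    using assms(2) by (simp add: poly_matrix_quadratic numeral_2_eq_2)
  then have "?q = 0"
    using is_minimal_poly_minimal_poly[of a] deg assms(1)
    unfolding is_minimal_poly_def by (metis order.trans not_less)
  then show ?thesis by simp
qed

text \<open>Testing on matrix units \<open>x\<close> turns the identity into linear relations between
  \<open>1\<close>, \<open>a\<close> and \<open>a\<^sup>2\<close> whose coefficients are entries of \<open>p\<close>, \<open>q\<close> and \<open>r\<close>.\<close>

lemma generalized_identity_trivial:
  fixes a p q r :: "'a::field^'n^'n"
  assumes deg: "degree (minimal_poly a) > 2"
    and id: "\<And>x. p ** x + q ** x ** a + r ** x ** (a ** a) = 0"
  shows "r = 0"
proof -
  have "r $ i $ k = 0" for i k
  proof -
    \<comment> \<open>Reading \<open>p ** x\<close> as \<open>p ** x ** mat 1\<close> gives all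
      three terms the same shape. With \<open>i\<close> and \<open>k\<close> fixed, varying
      \<open>l\<close> and \<open>j\<close> yields a full matrix relation.\<close>
    have "p $ i $ k * (mat 1 :: 'a^'n^'n) $ l $ j + q $ i $ k * a $ l $ j
        + r $ i $ k * (a ** a) $ l $ j = 0" for l j
      using arg_cong[OF id[of "matrix_unit k l"], of "\<lambda>A. A $ i $ j"]
        matrix_mult_matrix_unit_mult[of p k l "mat 1" i j]
      by (simp add: matrix_mult_matrix_unit_mult)
    then have "mat (p $ i $ k) + mat (q $ i $ k) ** a + mat (r $ i $ k) ** (a ** a) = 0"
      by (simp add: vec_eq_iff mat_scalar_mult_component mat_component if_distrib[of "(*) _"] cong: if_cong)
    from linear_independent_powers[OF deg this] show ?thesis by simp
  qed
  then show ?thesis by (simp add: vec_eq_iff)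
qed

lemma commutator_products_trace_annihilator:
  fixes a w :: "'a::field^'n^'n"
  assumes deg: "degree (minimal_poly a) > 2"
    and w: "\<And>x y. trace (w ** (commutator a x ** commutator a y)) = 0"
  shows "w = 0"
proof -
  have comm: "w ** commutator a x ** a = a ** (w ** commutator a x)" for x
  proof -
    define d where "d = w ** commutator a x"
    \<comment> \<open>Cyclicity of the trace moves the commutator with \<open>a\<close> from
      \<open>d\<close> onto \<open>y\<close>, where the hypothesis on \<open>w\<close>
      applies.\<close>
    have "trace ((d ** a - a ** d) ** y) = 0" for y
    proof -
      have "trace (a ** d ** y) = trace (d ** y ** a)"
        using trace_mul_sym[of a "d ** y"] by (simp add: matrix_mul_assoc)
      then have "trace ((d ** a - a ** d) ** y) = trace (d ** commutator a y)"
        by (simp add: commutator_def matrix_ring_simps trace_sub)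
      then show ?thesis using w[of x y] by (simp add: d_def matrix_mul_assoc)
    qed
    from trace_form_nondegenerate[OF this] show ?thesis by (simp add: d_def)
  qed
  \<comment> \<open>This is \<open>comm\<close> expanded and sorted by the power of \<open>a\<close>
    to the right of \<open>x\<close>; the coefficient at the square is \<open>w\<close>
    itself.\<close>
  have "(a ** w ** a) ** x + (- (w ** a) - a ** w) ** x ** a + w ** x ** (a ** a) = 0" for x
  proof -
    have neg: "(- A) ** B = - (A ** B)" for A B :: "'a^'n^'n"
      using matrix_sub_rdistrib[of 0 A B] by simp
    show ?thesis
      using comm[of x] by (simp add: commutator_def matrix_ring_simps neg algebra_simps)
  qed
  then show ?thesis by (rule generalized_identity_trivial[OF deg])
qed

section \<open>Degree at most 2\<close>

lemma commutator_product_commutes: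
  fixes a :: "'a::field^'n^'n"
  assumes sq: "a ** a = mat u + mat v ** a"
  shows "a ** (commutator a x ** commutator a y) = commutator a x ** commutator a y ** a"
proof -
  have swap: "a ** commutator a z + commutator a z ** a = mat v ** commutator a z" for z
  proof -
    \<comment> \<open>Bracketing with \<open>z\<close> is a derivation, so this is the bracket of
      \<open>a ** a\<close> with \<open>z\<close>; after substituting \<open>sq\<close>, the scalar
      \<open>u\<close> is central and drops out.\<close>
    have "a ** commutator a z + commutator a z ** a = (a ** a) ** z - z ** (a ** a)"
      by (simp add: commutator_def matrix_ring_simps)
    also have "\<dots> = mat v ** commutator a z"
      unfolding sq
      by (simp add: commutator_def matrix_ring_simps mat_mult_commute[of z])
    finally show ?thesis .
  qed
  let ?x = "commutator a x" and ?y = "commutator a y"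
  \<comment> \<open>Passing one commutator turns a into v - a; passing the second restores a, since
    v - (v - a) = a.\<close>
  have "a ** (?x ** ?y) = mat v ** ?x ** ?y - ?x ** (a ** ?y)"
    using arg_cong[OF swap[of x], of "\<lambda>A. A ** ?y"] by (simp add: matrix_ring_simps algebra_simps)
  also have "\<dots> = ?x ** (mat v ** ?y) - ?x ** (a ** ?y)"
    by (simp add: matrix_mul_assoc mat_mult_commute[of ?x])
  also have "\<dots> = ?x ** ?y ** a"
    unfolding swap[of y, symmetric] by (simp add: matrix_ring_simps)
  finally show ?thesis .
qed

text \<open>In degree 2 all the products commute with \<open>a\<close>, hence so do their sums; in
  degree 1 \<open>a\<close> is scalar; degree 0 cannot occur.\<close>

lemma central_if_sums_and_degree_le_2:
  fixes a :: "'a::field^'n^'n"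
  assumes sums: "\<And>b. \<exists>xys. b = (\<Sum>(x, y) \<leftarrow> xys. commutator a x ** commutator a y)"
    and deg: "degree (minimal_poly a) \<le> 2"
  shows "a ** b = b ** a"
proof -
  define r s t where "r = coeff (minimal_poly a) 0" and "s = coeff (minimal_poly a) 1"
    and "t = coeff (minimal_poly a) 2"
  have lead: "lead_coeff (minimal_poly a) = 1" and "poly_matrix (minimal_poly a) a = 0"
    using is_minimal_poly_minimal_poly[of a] by (auto simp: is_minimal_poly_def)
  then have rel: "mat r + mat s ** a + mat t ** (a ** a) = 0"
    using deg by (simp add: poly_matrix_quadratic r_def s_def t_def)
  show ?thesis
  proof (cases "t = 0")
    case False
    have "a ** a = mat (- r / t) + mat (- s / t) ** a"
    proof -
      have "(a ** a) $ i $ j = (mat (- r / t) + mat (- s / t) ** a) $ i $ j" for i j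
        using arg_cong[OF rel, of "\<lambda>A. A $ i $ j"] False
        by (simp add: mat_scalar_mult_component mat_component field_simps add_eq_0_iff)
      then show ?thesis by (simp add: vec_eq_iff)
    qed
    note comm = commutator_product_commutes[OF this]
    obtain xys where b: "b = (\<Sum>(x, y) \<leftarrow> xys. commutator a x ** commutator a y)"
      using sums by blast
    show ?thesis unfolding b
      by (induction xys) (auto simp: matrix_add_ldistrib matrix_add_rdistrib comm)
  next
    case t: True
    show ?thesis
    proof (cases "s = 0")
      case False
      have "a = mat (- r / s)"
      proof -
        have "a $ i $ j = (mat (- r / s)  :: 'a^'n^'n) $ i $ j" for i j
          using arg_cong[OF rel, of "\<lambda>A. A $ i $ j"] False t
          by (simp add: mat_scalar_mult_component mat_component field_simps add_eq_0_iff split: if_splits)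
        then show ?thesis by (simp add: vec_eq_iff)
      qed
      then show ?thesis by (simp add: mat_mult_commute)
    next
      case True
      \<comment> \<open>The relation is now \<open>mat r = 0\<close>; any diagonal entry gives
        \<open>r\<close>, so a monic polynomial would have leading coefficient 0.\<close>
      have "r = 0"
        using arg_cong[OF rel, of "\<lambda>A. A $ undefined $ undefined"] t True
        by (simp add: mat_component)
      with t True have "coeff (minimal_poly a) (degree (minimal_poly a)) = 0"
        using deg unfolding r_def s_def t_def
        by (metis One_nat_def Suc_1 le_SucE le_zero_eq)
      then show ?thesis using lead by simp
    qed
  qed
qed

theorem theoremD:
  fixes a :: "'a::field^'n^'n"
  assumes "CARD('n) \<ge> 2"
  shows "(\<forall>b :: 'a^'n^'n. \<exists>xys :: (('a^'n^'n) \<times> ('a^'n^'n)) list.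
            b = (\<Sum>(x, y) \<leftarrow> xys. commutator a x ** commutator a y))
         \<longleftrightarrow> degree (minimal_poly a) > 2"
proof
  assume sums: "\<forall>b :: 'a^'n^'n. \<exists>xys :: (('a^'n^'n) \<times> ('a^'n^'n)) list.
            b = (\<Sum>(x, y) \<leftarrow> xys. commutator a x ** commutator a y)"
  show "degree (minimal_poly a) > 2"
  proof (rule ccontr)
    assume "\<not> degree (minimal_poly a) > 2"
    then have zero: "commutator a x = 0" for x
      using central_if_sums_and_degree_le_2[of a x] sums by (simp add: commutator_def)
    obtain xys where "mat 1 = (\<Sum>(x, y) \<leftarrow> xys. commutator a x ** commutator a y)"
      using sums by blast
    also have "\<dots> = 0" by (induction xys) (auto simp: zero)
    finally have "mat 1 $ i $ i = (0 :: 'a^'n^'n) $ i $ i" for i by simp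
    then show False by (simp add: mat_component)
  qed
next
  assume deg: "degree (minimal_poly a) > 2"
  define V where "V = {b. \<exists>xys. b = (\<Sum>(x, y) \<leftarrow> xys. commutator a x ** commutator a y)}"
  have zero: "0 \<in> V"
    unfolding V_def by (auto intro: exI[of _ "[]"])
  have add: "A + B \<in> V" if "A \<in> V" "B \<in> V" for A B
  proof -
    from that obtain xs ys where "A = (\<Sum>(x, y) \<leftarrow> xs. commutator a x ** commutator a y)"
      "B = (\<Sum>(x, y) \<leftarrow> ys. commutator a x ** commutator a y)" by (auto simp: V_def)
    then show ?thesis unfolding V_def by (auto intro: exI[of _ "xs @ ys"])
  qed
  have scale: "mat c ** A \<in> V" if A: "A \<in> V" for c A
  proof -
    from A obtain xs where xs: "A = (\<Sum>(x, y) \<leftarrow> xs. commutator a x ** commutator a y)"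
      by (auto simp: V_def)
    \<comment> \<open>A scalar is absorbed into the first argument of each product, so sums without
      coefficients already form a subspace.\<close>
    have "commutator a (mat c ** x) = mat c ** commutator a x" for x
      by (simp add: commutator_def matrix_ring_simps mat_mult_commute[of a])
    then have "mat c ** A = (\<Sum>(x, y) \<leftarrow> map (\<lambda>(x, y). (mat c ** x, y)) xs.
        commutator a x ** commutator a y)"
      unfolding xs by (induction xs) (auto simp: matrix_add_ldistrib matrix_mul_assoc)
    then show ?thesis unfolding V_def by blast
  qed
  have gen: "commutator a x ** commutator a y \<in> V" for x y
    unfolding V_def by (auto intro: exI[of _ "[(x, y)]"])
  have "b \<in> V" for b
  proof (rule ccontr)
    assume "b \<notin> V"
    then obtain w where "w \<noteq> 0" "\<And>A. A \<in> V \<Longrightarrow> trace (w ** A) = 0"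
      using proper_subspace_trace_annihilator[OF zero add scale] by blast
    then show False
      using commutator_products_trace_annihilator[OF deg, of w] gen by blast
  qed
  then show "\<forall>b :: 'a^'n^'n. \<exists>xys :: (('a^'n^'n) \<times> ('a^'n^'n)) list.
            b = (\<Sum>(x, y) \<leftarrow> xys. commutator a x ** commutator a y)"
    by (auto simp: V_def)
qed

end
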